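(* A modal Nelson lattice $\mathbf{N}=\langle\mathbf{A},\blacksquare,\Diamond_N\rangle$ is a modal $\phi$-regular Nelson lattice if and only if its associated modal Heyting algebra $\mathbf{M}_\mathbf{N}=\langle\mathbf{H}_\mathbf{A},\square,\Diamond\rangle$ (so that $\mathbf{N}$ is isomorphic to a subalgebra of $\mathbf{N}(\mathbf{M}_\mathbf{N})$) is crisp-witnessed and the Heyting algebra $\mathbf{H}_\mathbf{A}$ satisfies the Stone identity $-x\vee --x=\top$.
   Context: A Nelson lattice is an involutive residuated lattice $\langle A,\wedge,\vee,*,\Rightarrow,\top,\bot\rangle$ ($\sim a=a\Rightarrow\bot$, $\sim\sim a=a$, $a^2=a*a$) satisfying $((a^2\Rightarrow b)\wedge((\sim b)^2\Rightarrow\sim a))\Rightarrow(a\Rightarrow b)=\top$. A modal Nelson lattice is $\langle\mathbf{A},\blacksquare,\Diamond_N\rangle$ (here $\Diamond_N$ denotes the Nelson-level diamond, written as a black lozenge in the paper) with $\mathbf{A}$ a Nelson lattice such that for all $a,b$: $\Diamond_N a=\sim\blacksquare\sim a$; if $a^2=b^2$ then $(\blacksquare a)^2=(\blacksquare b)^2$ and $(\Diamond_N a)^2=(\Diamond_N b)^2$; and $(\blacksquare a\wedge\Diamond_N(\sim a^2\wedge b))^2=\bot$. Define $\nabla(x)=\sim(\sim x^2)^2$, $\Delta(x)=(\sim(\sim x)^2)^2$, $\phi(x)=\Delta(x)\wedge(\nabla(x\vee\sim x)\vee x)$. A Nelson lattice is $\phi$-regular if $\phi(x\vee y)=\phi(x)\vee\phi(y)$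 and $\phi(x\wedge y)=\phi(x)\wedge\phi(y)$; a modal Nelson lattice is modal $\phi$-regular if its Nelson reduct is $\phi$-regular and $\blacksquare\phi(x)=\phi(\blacksquare x)$ for all $x$. A modal Heyting algebra is $\langle\mathbf{H},\square,\Diamond\rangle$ with $\mathbf{H}$ a Heyting algebra ($-a=a\rightharpoonup\bot$) and unary $\square,\Diamond$ satisfying $\square a\wedge\Diamond(-a\wedge b)=\bot$; it is crisp-witnessed if $--\square x=\square--x$ and $--\Diamond x=\Diamond--x$ for all $x$. The associated modal Heyting algebra of $\mathbf{N}$ is (up to isomorphism) $\langle H^*,\square^*,\Diamond^*\rangle$ with $H^*=\{a\in A:a^2=a\}$, $a\vee^*b=(a\vee b)^2$, $a\wedge^*b=(a\wedge b)^2$, $a\rightharpoonup^*b=(a^2\Rightarrow b)^2$, $\square^*a=(\blacksquare a)^2$, $\Diamond^*a=(\Diamond_N a)^2$. $\mathbf{N}(\mathbf{M})$ is the twist structure on $\{(x,y)\in H\times H:x\wedge y=\bot\}$ with $(x,y)\vee(s,t)=(x\vee s,y\wedge t)$, $(x,y)\wedge(s,t)=(x\wedge s,y\vee t)$, $(x,y)*(s,t)=(x\wedge s,(x\rightharpoonup t)\wedge(s\rightharpoonup y))$, $(x,y)\Rightarrow(s,t)=((x\rightharpoonup s)\wedge(t\rightharpoonup y),x\wedge t)$, $\blacksquare(x,y)=(\square x,\Diamond y)$, $\Diamond_N(x,y)=(\Diamond x,\square y)$. *)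

theory Defs
  imports "HOL-Algebra.Group"
begin

section \<open>Algebras with an explicit carrier\<close>

text \<open>
  The signature is purely algebraic (meet and join are operations, as in the associated Heyting
  algebra, whose operations are not the restrictions of those of the Nelson lattice), so the
  order-based lattices of \<^theory>\<open>HOL-Algebra.Lattice\<close> are not used; the order is
  defined by \<open>a \<le> b\<close> iff \<open>a \<and> b = a\<close>.
\<close>

record 'a implicative_lattice = "'a partial_object" +
  meet_op :: "'a \<Rightarrow> 'a \<Rightarrow> 'a" (infixl "\<^bold>\<and>\<index>" 70)
  join_op :: "'a \<Rightarrow> 'a \<Rightarrow> 'a" (infixl "\<^bold>\<or>\<index>" 65)
  imp_op :: "'a \<Rightarrow> 'a \<Rightarrow> 'a" (infixr "\<^bold>\<rightarrow>\<index>" 60)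
  top_el :: 'a ("\<^bold>\<top>\<index>")
  bot_el :: 'a ("\<^bold>\<bottom>\<index>")

record 'a residuated_struct = "'a implicative_lattice" +
  mult_op :: "'a \<Rightarrow> 'a \<Rightarrow> 'a" (infixl "\<^bold>*\<index>" 75)

record 'a modal_nelson_struct = "'a residuated_struct" +
  nbox :: "'a \<Rightarrow> 'a"
  ndia :: "'a \<Rightarrow> 'a"

record 'a modal_heyting_struct = "'a implicative_lattice" +
  hbox :: "'a \<Rightarrow> 'a"
  hdia :: "'a \<Rightarrow> 'a"

definition le_op :: "('a, 'm) implicative_lattice_scheme \<Rightarrow> 'a \<Rightarrow> 'a \<Rightarrow> bool"
    (infix "\<^bold>\<le>\<index>" 50) where
  "le_op L a b \<longleftrightarrow> meet_op L a b = a"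

definition neg_op :: "('a, 'm) implicative_lattice_scheme \<Rightarrow> 'a \<Rightarrow> 'a"
    ("\<^bold>\<not>\<index> _" [90] 90) where
  "neg_op L a = imp_op L a (bot_el L)"

definition sq :: "('a, 'm) residuated_struct_scheme \<Rightarrow> 'a \<Rightarrow> 'a" where
  "sq L a = mult_op L a a"

locale bounded_lattice_alg =
  fixes L (structure)
  assumes meet_closed: "\<lbrakk>a \<in> carrier L; b \<in> carrier L\<rbrakk> \<Longrightarrow> a \<^bold>\<and> b \<in> carrier L"
    and join_closed: "\<lbrakk>a \<in> carrier L; b \<in> carrier L\<rbrakk> \<Longrightarrow> a \<^bold>\<or> b \<in> carrier L"
    and imp_closed: "\<lbrakk>a \<in> carrier L; b \<in> carrier L\<rbrakk> \<Longrightarrow> a \<^bold>\<rightarrow> b \<in> carrier L"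
    and top_closed: "\<^bold>\<top> \<in> carrier L"
    and bot_closed: "\<^bold>\<bottom> \<in> carrier L"
    and meet_comm: "\<lbrakk>a \<in> carrier L; b \<in> carrier L\<rbrakk> \<Longrightarrow> a \<^bold>\<and> b = b \<^bold>\<and> a"
    and join_comm: "\<lbrakk>a \<in> carrier L; b \<in> carrier L\<rbrakk> \<Longrightarrow> a \<^bold>\<or> b = b \<^bold>\<or> a"
    and meet_assoc: "\<lbrakk>a \<in> carrier L; b \<in> carrier L; c \<in> carrier L\<rbrakk>
      \<Longrightarrow> (a \<^bold>\<and> b) \<^bold>\<and> c = a \<^bold>\<and> (b \<^bold>\<and> c)"
    and join_assoc: "\<lbrakk>a \<in> carrier L; b \<in> carrier L; c \<in> carrier L\<rbrakk>
      \<Longrightarrow> (a \<^bold>\<or> b) \<^bold>\<or> c = a \<^bold>\<or> (b \<^bold>\<or> c)"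
    and meet_join_absorb: "\<lbrakk>a \<in> carrier L; b \<in> carrier L\<rbrakk> \<Longrightarrow> a \<^bold>\<and> (a \<^bold>\<or> b) = a"
    and join_meet_absorb: "\<lbrakk>a \<in> carrier L; b \<in> carrier L\<rbrakk> \<Longrightarrow> a \<^bold>\<or> (a \<^bold>\<and> b) = a"
    and le_top: "a \<in> carrier L \<Longrightarrow> a \<^bold>\<le> \<^bold>\<top>"
    and bot_le: "a \<in> carrier L \<Longrightarrow> \<^bold>\<bottom> \<^bold>\<le> a"

section \<open>Nelson lattices\<close>

text \<open>Residuated lattices are commutative, bounded and integral: the unit of \<open>*\<close> is the top.\<close>

locale residuated_lattice = bounded_lattice_alg L for L (structure) +
  assumes mult_comm_monoid:
      "comm_monoid \<lparr>carrier = carrier L, monoid.mult = mult_op L, one = \<^bold>\<top>\<rparr>"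
    and residuation: "\<lbrakk>a \<in> carrier L; b \<in> carrier L; c \<in> carrier L\<rbrakk>
      \<Longrightarrow> a \<^bold>* b \<^bold>\<le> c \<longleftrightarrow> a \<^bold>\<le> b \<^bold>\<rightarrow> c"

locale nelson_lattice = residuated_lattice L for L (structure) +
  assumes involutive: "a \<in> carrier L \<Longrightarrow> \<^bold>\<not> \<^bold>\<not> a = a"
    and nelson: "\<lbrakk>a \<in> carrier L; b \<in> carrier L\<rbrakk>
      \<Longrightarrow> ((sq L a \<^bold>\<rightarrow> b) \<^bold>\<and> (sq L (\<^bold>\<not> b) \<^bold>\<rightarrow> \<^bold>\<not> a)) \<^bold>\<rightarrow> (a \<^bold>\<rightarrow> b) = \<^bold>\<top>"

locale modal_nelson_lattice = nelson_lattice N for N (structure) +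
  assumes nbox_closed: "a \<in> carrier N \<Longrightarrow> nbox N a \<in> carrier N"
    and ndia_closed: "a \<in> carrier N \<Longrightarrow> ndia N a \<in> carrier N"
    and ndia_eq: "a \<in> carrier N \<Longrightarrow> ndia N a = \<^bold>\<not> (nbox N (\<^bold>\<not> a))"
    and nbox_cong: "\<lbrakk>a \<in> carrier N; b \<in> carrier N; sq N a = sq N b\<rbrakk>
      \<Longrightarrow> sq N (nbox N a) = sq N (nbox N b)"
    and ndia_cong: "\<lbrakk>a \<in> carrier N; b \<in> carrier N; sq N a = sq N b\<rbrakk>
      \<Longrightarrow> sq N (ndia N a) = sq N (ndia N b)"
    and nbox_ndia: "\<lbrakk>a \<in> carrier N; b \<in> carrier N\<rbrakk>
      \<Longrightarrow> sq N (nbox N a \<^bold>\<and> ndia N (\<^bold>\<not> (sq N a) \<^bold>\<and> b)) = \<^bold>\<bottom>"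

text \<open>Throughout, \<open>\<sim>x\<^sup>2\<close> is \<open>\<sim>(x\<^sup>2)\<close>, as opposed to \<open>(\<sim>x)\<^sup>2\<close>.\<close>

definition nabla :: "('a, 'm) residuated_struct_scheme \<Rightarrow> 'a \<Rightarrow> 'a" where
  "nabla L x = neg_op L (sq L (neg_op L (sq L x)))"

definition delta :: "('a, 'm) residuated_struct_scheme \<Rightarrow> 'a \<Rightarrow> 'a" where
  "delta L x = sq L (neg_op L (sq L (neg_op L x)))"

definition phi :: "('a, 'm) residuated_struct_scheme \<Rightarrow> 'a \<Rightarrow> 'a" where
  "phi L x = meet_op L (delta L x) (join_op L (nabla L (join_op L x (neg_op L x))) x)"

locale phi_regular_nelson_lattice = nelson_lattice L for L (structure) +
  assumes phi_join: "\<lbrakk>x \<in> carrier L; y \<in> carrier L\<rbrakk> \<Longrightarrow> phi L (x \<^bold>\<or> y) = phi L x \<^bold>\<or> phi L y"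
    and phi_meet: "\<lbrakk>x \<in> carrier L; y \<in> carrier L\<rbrakk> \<Longrightarrow> phi L (x \<^bold>\<and> y) = phi L x \<^bold>\<and> phi L y"

locale modal_phi_regular_nelson_lattice =
  modal_nelson_lattice N + phi_regular_nelson_lattice N for N (structure) +
  assumes nbox_phi: "x \<in> carrier N \<Longrightarrow> nbox N (phi N x) = phi N (nbox N x)"

section \<open>Modal Heyting algebras\<close>

locale heyting_algebra = bounded_lattice_alg H for H (structure) +
  assumes heyting_residuation: "\<lbrakk>a \<in> carrier H; b \<in> carrier H; c \<in> carrier H\<rbrakk>
      \<Longrightarrow> a \<^bold>\<and> b \<^bold>\<le> c \<longleftrightarrow> a \<^bold>\<le> b \<^bold>\<rightarrow> c"

locale modal_heyting_algebra = heyting_algebra M for M (structure) +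
  assumes hbox_closed: "a \<in> carrier M \<Longrightarrow> hbox M a \<in> carrier M"
    and hdia_closed: "a \<in> carrier M \<Longrightarrow> hdia M a \<in> carrier M"
    and hbox_hdia: "\<lbrakk>a \<in> carrier M; b \<in> carrier M\<rbrakk>
      \<Longrightarrow> hbox M a \<^bold>\<and> hdia M (\<^bold>\<not> a \<^bold>\<and> b) = \<^bold>\<bottom>"

locale crisp_witnessed_modal_heyting_algebra = modal_heyting_algebra M for M (structure) +
  assumes crisp_box: "x \<in> carrier M \<Longrightarrow> \<^bold>\<not> \<^bold>\<not> (hbox M x) = hbox M (\<^bold>\<not> \<^bold>\<not> x)"
    and crisp_dia: "x \<in> carrier M \<Longrightarrow> \<^bold>\<not> \<^bold>\<not> (hdia M x) = hdia M (\<^bold>\<not> \<^bold>\<not> x)"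

definition stone_identity :: "('a, 'm) implicative_lattice_scheme \<Rightarrow> bool" where
  "stone_identity H \<longleftrightarrow>
    (\<forall>x\<in>carrier H. join_op H (neg_op H x) (neg_op H (neg_op H x)) = top_el H)"

section \<open>The associated modal Heyting algebra and the twist structure\<close>

definition assoc_modal_heyting ::
    "('a, 'm) modal_nelson_struct_scheme \<Rightarrow> 'a modal_heyting_struct" where
  "assoc_modal_heyting N =
    \<lparr>carrier = {a \<in> carrier N. sq N a = a},
     meet_op = (\<lambda>a b. sq N (meet_op N a b)),
     join_op = (\<lambda>a b. sq N (join_op N a b)),
     imp_op = (\<lambda>a b. sq N (imp_op N (sq N a) b)),
     top_el = top_el N,
     bot_el = bot_el N,
     hbox = (\<lambda>a. sq N (nbox N a)),
     hdia = (\<lambda>a. sq N (ndia N a))\<rparr>"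

definition twist ::
    "('a, 'm) modal_heyting_struct_scheme \<Rightarrow> ('a \<times> 'a) modal_nelson_struct" where
  "twist M =
    \<lparr>carrier = {(x, y). x \<in> carrier M \<and> y \<in> carrier M \<and> meet_op M x y = bot_el M},
     meet_op = (\<lambda>(x, y) (s, t). (meet_op M x s, join_op M y t)),
     join_op = (\<lambda>(x, y) (s, t). (join_op M x s, meet_op M y t)),
     imp_op = (\<lambda>(x, y) (s, t). (meet_op M (imp_op M x s) (imp_op M t y), meet_op M x t)),
     top_el = (top_el M, bot_el M),
     bot_el = (bot_el M, top_el M),
     mult_op = (\<lambda>(x, y) (s, t). (meet_op M x s, meet_op M (imp_op M x t) (imp_op M s y))),
     nbox = (\<lambda>(x, y). (hbox M x, hdia M y)),
     ndia = (\<lambda>(x, y). (hdia M x, hbox M y))\<rparr>"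

definition subuniverse :: "'a set \<Rightarrow> ('a, 'm) modal_nelson_struct_scheme \<Rightarrow> bool" where
  "subuniverse S B \<longleftrightarrow>
    S \<subseteq> carrier B \<and> top_el B \<in> S \<and> bot_el B \<in> S \<and>
    (\<forall>a\<in>S. \<forall>b\<in>S. meet_op B a b \<in> S \<and> join_op B a b \<in> S \<and> mult_op B a b \<in> S \<and> imp_op B a b \<in> S) \<and>
    (\<forall>a\<in>S. nbox B a \<in> S \<and> ndia B a \<in> S)"

definition modal_nelson_iso ::
    "('a, 'm) modal_nelson_struct_scheme \<Rightarrow> ('b, 'n) modal_nelson_struct_scheme \<Rightarrow> ('a \<Rightarrow> 'b) set" where
  "modal_nelson_iso A B =
    {h. bij_betw h (carrier A) (carrier B) \<and>
        h (top_el A) = top_el B \<and> h (bot_el A) = bot_el B \<and>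
        (\<forall>a\<in>carrier A. \<forall>b\<in>carrier A.
          h (meet_op A a b) = meet_op B (h a) (h b) \<and>
          h (join_op A a b) = join_op B (h a) (h b) \<and>
          h (mult_op A a b) = mult_op B (h a) (h b) \<and>
          h (imp_op A a b) = imp_op B (h a) (h b)) \<and>
        (\<forall>a\<in>carrier A. h (nbox A a) = nbox B (h a) \<and> h (ndia A a) = ndia B (h a))}"

definition isomorphic_to_subalgebra ::
    "('a, 'm) modal_nelson_struct_scheme \<Rightarrow> ('b, 'n) modal_nelson_struct_scheme \<Rightarrow> bool" where
  "isomorphic_to_subalgebra A B \<longleftrightarrow>
    (\<exists>S. subuniverse S B \<and> modal_nelson_iso A (B\<lparr>carrier := S\<rparr>) \<noteq> {})"

end

theory Submission
  imports Defs
begin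

text \<open>
  The map \<open>x \<mapsto> (x\<^sup>2, (\<sim>x)\<^sup>2)\<close> embeds a modal Nelson lattice into the twist structure of its
  associated modal Heyting algebra. In these coordinates \<open>\<phi>\<close> sends \<open>(a, b)\<close> to \<open>(--a, --b)\<close>.
  Every element of the Heyting algebra occurs as a first and as a second coordinate, so
  \<open>\<phi>\<close> commutes with the lattice operations iff double negation preserves joins, which is the
  Stone identity, and it commutes with the box iff double negation commutes with both modalities.
\<close>

section \<open>Lattices and Heyting algebras\<close>

context bounded_lattice_alg
begin

declare meet_closed [simp, intro] join_closed [simp, intro] imp_closed [simp, intro]
  top_closed [simp, intro] bot_closed [simp, intro] le_top [simp] bot_le [simp]

lemma neg_closed [simp, intro]: "a \<in> carrier L \<Longrightarrow> \<^bold>\<not> a \<in> carrier L"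
  by (simp add: neg_op_def)

lemma meet_left_comm:
  "\<lbrakk>a \<in> carrier L; b \<in> carrier L; c \<in> carrier L\<rbrakk> \<Longrightarrow> a \<^bold>\<and> (b \<^bold>\<and> c) = b \<^bold>\<and> (a \<^bold>\<and> c)"
  by (metis meet_assoc meet_comm)

lemmas meet_ac = meet_assoc meet_comm meet_left_comm

lemma meet_idem: "a \<in> carrier L \<Longrightarrow> a \<^bold>\<and> a = a"
  by (metis join_meet_absorb meet_join_absorb meet_closed)

lemma le_refl [simp]: "a \<in> carrier L \<Longrightarrow> a \<^bold>\<le> a"
  by (simp add: le_op_def meet_idem)

lemma le_antisym: "\<lbrakk>a \<^bold>\<le> b; b \<^bold>\<le> a; a \<in> carrier L; b \<in> carrier L\<rbrakk> \<Longrightarrow> a = b"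
  by (metis le_op_def meet_comm)

lemma le_trans:
  "\<lbrakk>a \<^bold>\<le> b; b \<^bold>\<le> c; a \<in> carrier L; b \<in> carrier L; c \<in> carrier L\<rbrakk> \<Longrightarrow> a \<^bold>\<le> c"
  by (metis le_op_def meet_assoc)

lemma meet_le1: "\<lbrakk>a \<in> carrier L; b \<in> carrier L\<rbrakk> \<Longrightarrow> a \<^bold>\<and> b \<^bold>\<le> a"
  by (metis le_op_def meet_assoc meet_comm meet_idem)

lemma meet_le2: "\<lbrakk>a \<in> carrier L; b \<in> carrier L\<rbrakk> \<Longrightarrow> a \<^bold>\<and> b \<^bold>\<le> b"
  by (metis meet_le1 meet_comm)

lemma le_meetI:
  "\<lbrakk>c \<^bold>\<le> a; c \<^bold>\<le> b; a \<in> carrier L; b \<in> carrier L; c \<in> carrier L\<rbrakk> \<Longrightarrow> c \<^bold>\<le> a \<^bold>\<and> b"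
  by (metis le_op_def meet_assoc)

lemma le_join1: "\<lbrakk>a \<in> carrier L; b \<in> carrier L\<rbrakk> \<Longrightarrow> a \<^bold>\<le> a \<^bold>\<or> b"
  by (simp add: le_op_def meet_join_absorb)

lemma le_join2: "\<lbrakk>a \<in> carrier L; b \<in> carrier L\<rbrakk> \<Longrightarrow> b \<^bold>\<le> a \<^bold>\<or> b"
  by (metis le_join1 join_comm)

lemma le_iff_join: "\<lbrakk>a \<in> carrier L; b \<in> carrier L\<rbrakk> \<Longrightarrow> a \<^bold>\<le> b \<longleftrightarrow> a \<^bold>\<or> b = b"
  by (metis le_op_def join_comm join_meet_absorb meet_comm meet_join_absorb)

lemma join_leI:
  "\<lbrakk>a \<^bold>\<le> c; b \<^bold>\<le> c; a \<in> carrier L; b \<in> carrier L; c \<in> carrier L\<rbrakk> \<Longrightarrow> a \<^bold>\<or> b \<^bold>\<le> c"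
  by (simp add: le_iff_join join_assoc)

lemma le_bot_iff: "a \<in> carrier L \<Longrightarrow> a \<^bold>\<le> \<^bold>\<bottom> \<longleftrightarrow> a = \<^bold>\<bottom>"
  by (metis bot_closed bot_le le_antisym le_refl)

lemma top_le_iff: "a \<in> carrier L \<Longrightarrow> \<^bold>\<top> \<^bold>\<le> a \<longleftrightarrow> a = \<^bold>\<top>"
  by (metis top_closed le_top le_antisym le_refl)

lemma join_bot: "a \<in> carrier L \<Longrightarrow> a \<^bold>\<or> \<^bold>\<bottom> = a"
  by (metis bot_closed bot_le join_comm le_iff_join)

end

section \<open>Pseudocomplements and double negation in Heyting algebras\<close>

context heyting_algebra
begin

lemma le_neg_iff:
  assumes "a \<in> carrier H" "b \<in> carrier H"
  shows "a \<^bold>\<le> \<^bold>\<not> b \<longleftrightarrow> a \<^bold>\<and> b = \<^bold>\<bottom>"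
  using assms by (metis bot_closed heyting_residuation le_bot_iff meet_closed neg_op_def)

text \<open>Disjointness is symmetric, so negation is adjoint to itself. From this symmetry come
  \<open>le_dneg\<close>, \<open>neg_antimono\<close> and \<open>neg_neg_neg\<close>.\<close>

lemma neg_galois:
  "\<lbrakk>a \<in> carrier H; b \<in> carrier H\<rbrakk> \<Longrightarrow> a \<^bold>\<le> \<^bold>\<not> b \<longleftrightarrow> b \<^bold>\<le> \<^bold>\<not> a"
  by (metis le_neg_iff meet_comm)

lemma le_dneg: "a \<in> carrier H \<Longrightarrow> a \<^bold>\<le> \<^bold>\<not> \<^bold>\<not> a"
  by (metis neg_galois neg_closed le_refl)

lemma meet_neg: "a \<in> carrier H \<Longrightarrow> \<^bold>\<not> a \<^bold>\<and> a = \<^bold>\<bottom>"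
  by (metis le_neg_iff le_refl neg_closed)

lemma neg_antimono: "\<lbrakk>a \<^bold>\<le> b; a \<in> carrier H; b \<in> carrier H\<rbrakk> \<Longrightarrow> \<^bold>\<not> b \<^bold>\<le> \<^bold>\<not> a"
  by (metis le_dneg le_trans neg_closed neg_galois)

lemma neg_neg_neg: "a \<in> carrier H \<Longrightarrow> \<^bold>\<not> \<^bold>\<not> \<^bold>\<not> a = \<^bold>\<not> a"
  by (metis le_antisym le_dneg neg_antimono neg_closed)

lemma neg_join:
  assumes "a \<in> carrier H" "b \<in> carrier H"
  shows "\<^bold>\<not> (a \<^bold>\<or> b) = \<^bold>\<not> a \<^bold>\<and> \<^bold>\<not> b"
proof (rule le_antisym)
  show "\<^bold>\<not> (a \<^bold>\<or> b) \<^bold>\<le> \<^bold>\<not> a \<^bold>\<and> \<^bold>\<not> b"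
    using assms by (simp add: le_join1 le_join2 le_meetI neg_antimono)
  have "a \<^bold>\<le> \<^bold>\<not> (\<^bold>\<not> a \<^bold>\<and> \<^bold>\<not> b)" "b \<^bold>\<le> \<^bold>\<not> (\<^bold>\<not> a \<^bold>\<and> \<^bold>\<not> b)"
    using assms by (metis meet_closed meet_le1 meet_le2 neg_closed neg_galois)+
  then show "\<^bold>\<not> a \<^bold>\<and> \<^bold>\<not> b \<^bold>\<le> \<^bold>\<not> (a \<^bold>\<or> b)"
    using assms by (metis join_closed join_leI meet_closed neg_closed neg_galois)
qed (use assms in auto)

text \<open>Case distinction along a cover of the top: \<open>x\<close> and \<open>y\<close> both
  lie below the implication from \<open>u\<close> to \<open>c\<close>, hence so does their join.
  Residuation takes the place of a distributive law here.\<close>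

lemma le_cases:
  assumes "x \<^bold>\<or> y = \<^bold>\<top>" "u \<^bold>\<and> x \<^bold>\<le> c" "u \<^bold>\<and> y \<^bold>\<le> c"
    and carr: "x \<in> carrier H" "y \<in> carrier H" "u \<in> carrier H" "c \<in> carrier H"
  shows "u \<^bold>\<le> c"
proof -
  have "x \<^bold>\<le> u \<^bold>\<rightarrow> c" "y \<^bold>\<le> u \<^bold>\<rightarrow> c"
    using assms by (simp_all add: meet_comm flip: heyting_residuation)
  then have "\<^bold>\<top> \<^bold>\<le> u \<^bold>\<rightarrow> c"
    using assms(1) carr join_leI[of x "u \<^bold>\<rightarrow> c" y] by simp
  then show ?thesis
    using carr by (metis heyting_residuation le_op_def le_top meet_comm top_closed)
qed

lemma dneg_mono: "\<lbrakk>a \<^bold>\<le> b; a \<in> carrier H; b \<in> carrier H\<rbrakk> \<Longrightarrow> \<^bold>\<not> \<^bold>\<not> a \<^bold>\<le> \<^bold>\<not> \<^bold>\<not> b"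
  by (simp add: neg_antimono)

text \<open>For the harder inequality, start from the disjointness of \<open>-(a \<and> b)\<close>,
  \<open>a\<close> and \<open>b\<close>. Being disjoint from \<open>b\<close> means being below
  \<open>-b = ---b\<close>, that is, being disjoint from \<open>--b\<close>. So \<open>b\<close>,
  and then \<open>a\<close>, can be replaced by its double negation.\<close>

lemma dneg_meet:
  assumes "a \<in> carrier H" "b \<in> carrier H"
  shows "\<^bold>\<not> \<^bold>\<not> (a \<^bold>\<and> b) = \<^bold>\<not> \<^bold>\<not> a \<^bold>\<and> \<^bold>\<not> \<^bold>\<not> b"
proof (rule le_antisym)
  show "\<^bold>\<not> \<^bold>\<not> (a \<^bold>\<and> b) \<^bold>\<le> \<^bold>\<not> \<^bold>\<not> a \<^bold>\<and> \<^bold>\<not> \<^bold>\<not> b"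
    using assms by (simp add: dneg_mono le_meetI meet_le1 meet_le2)
  let ?n = "\<^bold>\<not> (a \<^bold>\<and> b)"
  have carr: "?n \<in> carrier H" "\<^bold>\<not> \<^bold>\<not> a \<in> carrier H" "\<^bold>\<not> \<^bold>\<not> b \<in> carrier H"
    using assms by auto
  have "(?n \<^bold>\<and> a) \<^bold>\<and> b = \<^bold>\<bottom>"
    using assms by (simp add: meet_assoc meet_neg)
  then have "(?n \<^bold>\<and> a) \<^bold>\<le> \<^bold>\<not> \<^bold>\<not> \<^bold>\<not> b"
    using assms by (simp add: neg_neg_neg le_neg_iff)
  then have "(?n \<^bold>\<and> a) \<^bold>\<and> \<^bold>\<not> \<^bold>\<not> b = \<^bold>\<bottom>"
    using assms le_neg_iff by auto
  then have "(?n \<^bold>\<and> \<^bold>\<not> \<^bold>\<not> b) \<^bold>\<and> a = \<^bold>\<bottom>"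
    using assms carr by (simp add: meet_ac)
  then have "?n \<^bold>\<and> \<^bold>\<not> \<^bold>\<not> b \<^bold>\<le> \<^bold>\<not> \<^bold>\<not> \<^bold>\<not> a"
    using assms by (simp add: neg_neg_neg le_neg_iff)
  then have "(?n \<^bold>\<and> \<^bold>\<not> \<^bold>\<not> b) \<^bold>\<and> \<^bold>\<not> \<^bold>\<not> a = \<^bold>\<bottom>"
    using assms le_neg_iff by auto
  then have "(\<^bold>\<not> \<^bold>\<not> a \<^bold>\<and> \<^bold>\<not> \<^bold>\<not> b) \<^bold>\<and> ?n = \<^bold>\<bottom>"
    using carr by (simp add: meet_ac)
  then show "\<^bold>\<not> \<^bold>\<not> a \<^bold>\<and> \<^bold>\<not> \<^bold>\<not> b \<^bold>\<le> \<^bold>\<not> ?n"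
    using assms by (simp add: le_neg_iff)
qed (use assms in auto)

text \<open>The Stone identity for \<open>a\<close> and for \<open>b\<close> splits the top.
  Wherever \<open>--a\<close> or \<open>--b\<close> is present the bound is immediate; what is left
  is the part below both negations.\<close>

lemma stone_dneg_join:
  assumes stone: "stone_identity H" and carr: "a \<in> carrier H" "b \<in> carrier H"
  shows "\<^bold>\<not> \<^bold>\<not> (a \<^bold>\<or> b) = \<^bold>\<not> \<^bold>\<not> a \<^bold>\<or> \<^bold>\<not> \<^bold>\<not> b"
proof (rule le_antisym)
  show "\<^bold>\<not> \<^bold>\<not> a \<^bold>\<or> \<^bold>\<not> \<^bold>\<not> b \<^bold>\<le> \<^bold>\<not> \<^bold>\<not> (a \<^bold>\<or> b)"
    using carr by (simp add: dneg_mono join_leI le_join1 le_join2)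
  let ?u = "\<^bold>\<not> \<^bold>\<not> (a \<^bold>\<or> b)" and ?c = "\<^bold>\<not> \<^bold>\<not> a \<^bold>\<or> \<^bold>\<not> \<^bold>\<not> b"
  have st: "\<^bold>\<not> x \<^bold>\<or> \<^bold>\<not> \<^bold>\<not> x = \<^bold>\<top>" if "x \<in> carrier H" for x
    using stone that by (simp add: stone_identity_def)
  show "?u \<^bold>\<le> ?c"
  proof (rule le_cases[OF st[OF carr(1)]])
    show "?u \<^bold>\<and> \<^bold>\<not> a \<^bold>\<le> ?c"
    proof (rule le_cases[OF st[OF carr(2)]])
      \<comment> \<open>Here \<open>-a \<and> -b\<close> equals \<open>-(a \<or> b)\<close>, which
        is disjoint from its own negation \<open>?u\<close>.\<close>
      have "(?u \<^bold>\<and> \<^bold>\<not> a) \<^bold>\<and> \<^bold>\<not> b = \<^bold>\<bottom>"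
        using carr meet_neg[of "\<^bold>\<not> (a \<^bold>\<or> b)"] by (simp add: meet_assoc neg_join)
      then show "(?u \<^bold>\<and> \<^bold>\<not> a) \<^bold>\<and> \<^bold>\<not> b \<^bold>\<le> ?c"
        using carr by simp
      show "(?u \<^bold>\<and> \<^bold>\<not> a) \<^bold>\<and> \<^bold>\<not> \<^bold>\<not> b \<^bold>\<le> ?c"
        using carr by (meson join_closed le_join2 le_trans meet_closed meet_le2 neg_closed)
    qed (use carr in auto)
    show "?u \<^bold>\<and> \<^bold>\<not> \<^bold>\<not> a \<^bold>\<le> ?c"
      using carr by (meson join_closed le_join1 le_trans meet_closed meet_le2 neg_closed)
  qed (use carr in auto)
qed (use carr in auto)

text \<open>The negation of \<open>a \<or> -a\<close> is \<open>-a \<and> --a\<close>, which is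
  bottom. This turns preservation of joins by double negation into the Stone identity.\<close>

lemma dneg_join_neg:
  assumes "a \<in> carrier H"
  shows "\<^bold>\<not> \<^bold>\<not> (a \<^bold>\<or> \<^bold>\<not> a) = \<^bold>\<top>"
proof -
  have "\<^bold>\<not> (a \<^bold>\<or> \<^bold>\<not> a) = \<^bold>\<bottom>"
    using assms by (metis meet_comm meet_neg neg_closed neg_join)
  then show ?thesis
    by (metis bot_closed bot_le neg_closed neg_galois top_closed top_le_iff)
qed

text \<open>With \<open>a\<close> and \<open>b\<close> read as the squares of \<open>x\<close> and
  \<open>~x\<close>, the left side is the first coordinate of \<open>phi\<close>. The element
  \<open>-b \<and> --(a \<or> b)\<close> is disjoint from \<open>-a\<close>, because
  \<open>-a \<and> -b\<close> is \<open>-(a \<or> b)\<close>; conversely, disjointness of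
  \<open>a\<close> and \<open>b\<close> gives \<open>--a \<le> -b\<close>.\<close>

lemma phi_fst:
  assumes "a \<^bold>\<and> b = \<^bold>\<bottom>" and carr: "a \<in> carrier H" "b \<in> carrier H"
  shows "\<^bold>\<not> b \<^bold>\<and> (\<^bold>\<not> \<^bold>\<not> (a \<^bold>\<or> b) \<^bold>\<or> a) = \<^bold>\<not> \<^bold>\<not> a"
proof -
  have "a \<^bold>\<le> \<^bold>\<not> \<^bold>\<not> (a \<^bold>\<or> b)"
    using carr by (meson join_closed le_dneg le_join1 le_trans neg_closed)
  then have *: "\<^bold>\<not> \<^bold>\<not> (a \<^bold>\<or> b) \<^bold>\<or> a = \<^bold>\<not> \<^bold>\<not> (a \<^bold>\<or> b)"
    using carr by (metis join_closed join_comm le_iff_join neg_closed)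
  have "\<^bold>\<not> b \<^bold>\<and> \<^bold>\<not> \<^bold>\<not> (a \<^bold>\<or> b) = \<^bold>\<not> \<^bold>\<not> a"
  proof (rule le_antisym)
    have "(\<^bold>\<not> a \<^bold>\<and> \<^bold>\<not> b) \<^bold>\<and> \<^bold>\<not> \<^bold>\<not> (a \<^bold>\<or> b) = \<^bold>\<bottom>"
      using carr by (metis neg_join neg_closed join_closed meet_comm meet_neg)
    then have "(\<^bold>\<not> b \<^bold>\<and> \<^bold>\<not> \<^bold>\<not> (a \<^bold>\<or> b)) \<^bold>\<and> \<^bold>\<not> a = \<^bold>\<bottom>"
      using carr by (simp add: meet_ac)
    then show "\<^bold>\<not> b \<^bold>\<and> \<^bold>\<not> \<^bold>\<not> (a \<^bold>\<or> b) \<^bold>\<le> \<^bold>\<not> \<^bold>\<not> a"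
      using carr by (simp add: le_neg_iff)
    have "b \<^bold>\<le> \<^bold>\<not> a"
      using assms by (simp add: le_neg_iff meet_comm)
    then have "\<^bold>\<not> \<^bold>\<not> a \<^bold>\<le> \<^bold>\<not> b"
      using carr by (simp add: neg_antimono)
    then show "\<^bold>\<not> \<^bold>\<not> a \<^bold>\<le> \<^bold>\<not> b \<^bold>\<and> \<^bold>\<not> \<^bold>\<not> (a \<^bold>\<or> b)"
      using carr by (simp add: le_meetI dneg_mono le_join1)
  qed (use carr in auto)
  with * show ?thesis by simp
qed

text \<open>The left side is the second coordinate of \<open>phi\<close>; its inner meet vanishes
  because \<open>b\<close> lies below \<open>a \<or> b\<close>.\<close>

lemma phi_snd:
  assumes "a \<in> carrier H" "b \<in> carrier H"
  shows "\<^bold>\<not> \<^bold>\<not> b \<^bold>\<or> (\<^bold>\<not> (a \<^bold>\<or> b) \<^bold>\<and> b) = \<^bold>\<not> \<^bold>\<not> b"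
proof -
  have "\<^bold>\<not> (a \<^bold>\<or> b) \<^bold>\<and> b = \<^bold>\<bottom>"
    using assms by (metis join_closed le_join2 le_neg_iff neg_antimono neg_closed)
  with assms show ?thesis by (simp add: join_bot)
qed

end

section \<open>Squares in Nelson lattices\<close>

context residuated_lattice
begin

lemma mult_closed [simp, intro]: "\<lbrakk>a \<in> carrier L; b \<in> carrier L\<rbrakk> \<Longrightarrow> a \<^bold>* b \<in> carrier L"
  using monoid.m_closed[OF comm_monoid.axioms(1)[OF mult_comm_monoid]] by simp

lemma mult_assoc:
  "\<lbrakk>a \<in> carrier L; b \<in> carrier L; c \<in> carrier L\<rbrakk> \<Longrightarrow> (a \<^bold>* b) \<^bold>* c = a \<^bold>* (b \<^bold>* c)"
  using monoid.m_assoc[OF comm_monoid.axioms(1)[OF mult_comm_monoid]] by simp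

lemma mult_comm: "\<lbrakk>a \<in> carrier L; b \<in> carrier L\<rbrakk> \<Longrightarrow> a \<^bold>* b = b \<^bold>* a"
  using comm_monoid.m_comm[OF mult_comm_monoid] by simp

lemma mult_left_comm:
  "\<lbrakk>a \<in> carrier L; b \<in> carrier L; c \<in> carrier L\<rbrakk> \<Longrightarrow> a \<^bold>* (b \<^bold>* c) = b \<^bold>* (a \<^bold>* c)"
  by (metis mult_assoc mult_comm)

lemmas mult_ac = mult_assoc mult_comm mult_left_comm

lemma top_mult: "a \<in> carrier L \<Longrightarrow> \<^bold>\<top> \<^bold>* a = a"
  using monoid.l_one[OF comm_monoid.axioms(1)[OF mult_comm_monoid]] by simp

lemma mult_mono1:
  "\<lbrakk>a \<^bold>\<le> b; a \<in> carrier L; b \<in> carrier L; c \<in> carrier L\<rbrakk> \<Longrightarrow> a \<^bold>* c \<^bold>\<le> b \<^bold>* c"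
  by (metis imp_closed le_refl le_trans mult_closed residuation)

lemma mult_mono:
  "\<lbrakk>a \<^bold>\<le> b; c \<^bold>\<le> d; a \<in> carrier L; b \<in> carrier L; c \<in> carrier L; d \<in> carrier L\<rbrakk>
    \<Longrightarrow> a \<^bold>* c \<^bold>\<le> b \<^bold>* d"
  by (metis le_trans mult_closed mult_comm mult_mono1)

lemma mult_le2: "\<lbrakk>a \<in> carrier L; b \<in> carrier L\<rbrakk> \<Longrightarrow> a \<^bold>* b \<^bold>\<le> b"
  by (metis le_top mult_mono1 top_closed top_mult)

lemma mult_le1: "\<lbrakk>a \<in> carrier L; b \<in> carrier L\<rbrakk> \<Longrightarrow> a \<^bold>* b \<^bold>\<le> a"
  by (metis mult_comm mult_le2)

lemma sq_closed [simp, intro]: "a \<in> carrier L \<Longrightarrow> sq L a \<in> carrier L"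
  by (simp add: sq_def)

lemma sq_mono: "\<lbrakk>a \<^bold>\<le> b; a \<in> carrier L; b \<in> carrier L\<rbrakk> \<Longrightarrow> sq L a \<^bold>\<le> sq L b"
  by (simp add: sq_def mult_mono)

lemma sq_le: "a \<in> carrier L \<Longrightarrow> sq L a \<^bold>\<le> a"
  by (simp add: sq_def mult_le1)

lemma sq_mult: "\<lbrakk>a \<in> carrier L; b \<in> carrier L\<rbrakk> \<Longrightarrow> sq L (a \<^bold>* b) = sq L a \<^bold>* sq L b"
  by (simp add: sq_def mult_ac)

lemma imp_mult_le: "\<lbrakk>a \<in> carrier L; b \<in> carrier L\<rbrakk> \<Longrightarrow> (a \<^bold>\<rightarrow> b) \<^bold>* a \<^bold>\<le> b"
  by (simp add: residuation)

lemma imp_eq_top_iff: "\<lbrakk>a \<in> carrier L; b \<in> carrier L\<rbrakk> \<Longrightarrow> a \<^bold>\<rightarrow> b = \<^bold>\<top> \<longleftrightarrow> a \<^bold>\<le> b"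
  by (metis imp_closed residuation top_closed top_le_iff top_mult)

lemma neg_mult: "a \<in> carrier L \<Longrightarrow> \<^bold>\<not> a \<^bold>* a = \<^bold>\<bottom>"
  by (metis bot_closed imp_mult_le le_bot_iff mult_closed neg_closed neg_op_def)

text \<open>Multiplication by \<open>c\<close> has a right adjoint, so a product with a join can be
  bounded summand by summand.\<close>

lemma mult_join_le:
  assumes "a \<^bold>* c \<^bold>\<le> d" "b \<^bold>* c \<^bold>\<le> d"
    "a \<in> carrier L" "b \<in> carrier L" "c \<in> carrier L" "d \<in> carrier L"
  shows "(a \<^bold>\<or> b) \<^bold>* c \<^bold>\<le> d"
  using assms by (simp add: residuation join_leI)

end

section \<open>The involution, the Nelson inequality and squaring\<close>

context nelson_lattice
begin

lemma le_neg_iff_mult: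
  "\<lbrakk>a \<in> carrier L; b \<in> carrier L\<rbrakk> \<Longrightarrow> a \<^bold>\<le> \<^bold>\<not> b \<longleftrightarrow> a \<^bold>* b = \<^bold>\<bottom>"
  by (metis bot_closed le_bot_iff mult_closed neg_op_def residuation)

lemma neg_antimono_iff: "\<lbrakk>a \<in> carrier L; b \<in> carrier L\<rbrakk> \<Longrightarrow> \<^bold>\<not> b \<^bold>\<le> \<^bold>\<not> a \<longleftrightarrow> a \<^bold>\<le> b"
  by (metis involutive le_neg_iff_mult mult_comm neg_closed)

text \<open>Both sides have the same lower bounds: \<open>c * a \<le> b\<close> amounts to
  \<open>c * a * ~b = \<bottom>\<close>, since \<open>b\<close> is the negation of
  \<open>~b\<close>.\<close>

lemma imp_eq_neg_mult:
  assumes carr: "a \<in> carrier L" "b \<in> carrier L"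
  shows "a \<^bold>\<rightarrow> b = \<^bold>\<not> (a \<^bold>* \<^bold>\<not> b)"
proof -
  have "c \<^bold>\<le> a \<^bold>\<rightarrow> b \<longleftrightarrow> c \<^bold>\<le> \<^bold>\<not> (a \<^bold>* \<^bold>\<not> b)" if "c \<in> carrier L" for c
    using that carr le_neg_iff_mult[of "c \<^bold>* a" "\<^bold>\<not> b"]
    by (simp add: le_neg_iff_mult involutive mult_assoc flip: residuation)
  then show ?thesis
    using carr by (meson imp_closed le_antisym le_refl mult_closed neg_closed)
qed

lemma neg_imp: "\<lbrakk>a \<in> carrier L; b \<in> carrier L\<rbrakk> \<Longrightarrow> \<^bold>\<not> (a \<^bold>\<rightarrow> b) = a \<^bold>* \<^bold>\<not> b"
  by (simp add: imp_eq_neg_mult involutive)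

lemma neg_mult_eq_imp: "\<lbrakk>a \<in> carrier L; b \<in> carrier L\<rbrakk> \<Longrightarrow> \<^bold>\<not> (a \<^bold>* b) = a \<^bold>\<rightarrow> \<^bold>\<not> b"
  by (simp add: imp_eq_neg_mult involutive)

lemma imp_contrapos: "\<lbrakk>a \<in> carrier L; b \<in> carrier L\<rbrakk> \<Longrightarrow> a \<^bold>\<rightarrow> b = \<^bold>\<not> b \<^bold>\<rightarrow> \<^bold>\<not> a"
  by (simp add: imp_eq_neg_mult involutive mult_comm)

lemma neg_bot: "\<^bold>\<not> \<^bold>\<bottom> = \<^bold>\<top>"
  by (metis bot_closed imp_eq_top_iff le_refl neg_op_def)

lemma neg_top: "\<^bold>\<not> \<^bold>\<top> = \<^bold>\<bottom>"
  by (metis bot_closed involutive neg_bot)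

lemma neg_meet:
  assumes carr: "a \<in> carrier L" "b \<in> carrier L"
  shows "\<^bold>\<not> (a \<^bold>\<and> b) = \<^bold>\<not> a \<^bold>\<or> \<^bold>\<not> b"
proof (rule le_antisym)
  show "\<^bold>\<not> a \<^bold>\<or> \<^bold>\<not> b \<^bold>\<le> \<^bold>\<not> (a \<^bold>\<and> b)"
    using carr by (simp add: join_leI neg_antimono_iff meet_le1 meet_le2)
  have "\<^bold>\<not> (\<^bold>\<not> a \<^bold>\<or> \<^bold>\<not> b) \<^bold>\<le> a" "\<^bold>\<not> (\<^bold>\<not> a \<^bold>\<or> \<^bold>\<not> b) \<^bold>\<le> b"
    using carr by (metis involutive join_closed le_join1 le_join2 neg_antimono_iff neg_closed)+
  then have "\<^bold>\<not> (\<^bold>\<not> a \<^bold>\<or> \<^bold>\<not> b) \<^bold>\<le> a \<^bold>\<and> b"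
    using carr by (simp add: le_meetI)
  then show "\<^bold>\<not> (a \<^bold>\<and> b) \<^bold>\<le> \<^bold>\<not> a \<^bold>\<or> \<^bold>\<not> b"
    using carr by (metis involutive join_closed meet_closed neg_antimono_iff neg_closed)
qed (use carr in auto)

lemma neg_join: "\<lbrakk>a \<in> carrier L; b \<in> carrier L\<rbrakk> \<Longrightarrow> \<^bold>\<not> (a \<^bold>\<or> b) = \<^bold>\<not> a \<^bold>\<and> \<^bold>\<not> b"
  by (metis involutive meet_closed neg_closed neg_meet)

text \<open>The Nelson identity moved through residuation, with a parameter \<open>c\<close> that
  collects side conditions.\<close>

lemma nelson_le:
  assumes "c \<^bold>* sq L a \<^bold>\<le> b" "c \<^bold>* sq L (\<^bold>\<not> b) \<^bold>\<le> \<^bold>\<not> a"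
    and carr: "a \<in> carrier L" "b \<in> carrier L" "c \<in> carrier L"
  shows "c \<^bold>\<le> a \<^bold>\<rightarrow> b"
proof -
  have "c \<^bold>\<le> (sq L a \<^bold>\<rightarrow> b) \<^bold>\<and> (sq L (\<^bold>\<not> b) \<^bold>\<rightarrow> \<^bold>\<not> a)"
    using assms by (simp add: residuation le_meetI)
  moreover have "(sq L a \<^bold>\<rightarrow> b) \<^bold>\<and> (sq L (\<^bold>\<not> b) \<^bold>\<rightarrow> \<^bold>\<not> a) \<^bold>\<le> a \<^bold>\<rightarrow> b"
    using carr nelson by (simp flip: imp_eq_top_iff)
  ultimately show ?thesis
    using carr by (meson le_trans imp_closed meet_closed neg_closed sq_closed)
qed

lemma le_of_sq_le:
  assumes "sq L a \<^bold>\<le> b" "sq L (\<^bold>\<not> b) \<^bold>\<le> \<^bold>\<not> a"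
    and carr: "a \<in> carrier L" "b \<in> carrier L"
  shows "a \<^bold>\<le> b"
  using assms nelson_le[of "\<^bold>\<top>" a b] by (simp add: top_mult top_le_iff imp_eq_top_iff)

text \<open>Injectivity of the map \<open>x \<mapsto> (x^2, (~x)^2)\<close>. It is also the tool by
  which identities in the Nelson lattice are checked coordinatewise.\<close>

lemma eq_of_sq_eq:
  assumes "sq L a = sq L b" "sq L (\<^bold>\<not> a) = sq L (\<^bold>\<not> b)"
    and "a \<in> carrier L" "b \<in> carrier L"
  shows "a = b"
  using assms by (metis le_antisym le_of_sq_le sq_le neg_closed)

text \<open>Since \<open>\<sim>(a \<Rightarrow> a\<^sup>3) = a * \<sim>a\<^sup>3\<close>, the Nelson inequality gives \<open>a \<le> a \<Rightarrow> a\<^sup>3\<close>, that is,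
  \<open>a\<^sup>2 = a\<^sup>3\<close>.\<close>

lemma sq_sq [simp]:
  assumes carr: "a \<in> carrier L"
  shows "sq L (sq L a) = sq L a"
proof (rule le_antisym)
  let ?c = "sq L a \<^bold>* a"
  have "sq L a \<^bold>\<le> a \<^bold>\<rightarrow> ?c"
    using carr by (simp flip: residuation)
  moreover have "sq L (\<^bold>\<not> (a \<^bold>\<rightarrow> ?c)) \<^bold>\<le> \<^bold>\<not> a"
  proof -
    \<comment> \<open>The square contributes two factors \<open>a\<close>; with the one outside they
      form \<open>?c\<close>, the cube of \<open>a\<close>.\<close>
    have "sq L (\<^bold>\<not> (a \<^bold>\<rightarrow> ?c)) \<^bold>* a = \<^bold>\<not> ?c \<^bold>* (\<^bold>\<not> ?c \<^bold>* ?c)"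
      using carr by (simp add: neg_imp sq_def mult_ac)
    also have "\<dots> = \<^bold>\<bottom>"
      using carr by (simp add: neg_mult le_bot_iff[symmetric] mult_le2)
    finally show ?thesis
      using carr by (simp add: le_neg_iff_mult)
  qed
  ultimately have "a \<^bold>\<le> a \<^bold>\<rightarrow> ?c"
    using carr by (simp add: le_of_sq_le)
  then have le: "sq L a \<^bold>\<le> ?c"
    using carr by (simp add: sq_def residuation)
  \<comment> \<open>One further factor \<open>a\<close> gives \<open>a^3 \<le> a^4\<close>, and
    \<open>a^4\<close> is the square of \<open>a^2\<close>.\<close>
  then have "?c \<^bold>\<le> ?c \<^bold>* a"
    using carr by (simp add: mult_mono1)
  then show "sq L a \<^bold>\<le> sq L (sq L a)"
    using carr le le_trans[of "sq L a" ?c "?c \<^bold>* a"]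
    by (simp add: sq_def mult_assoc)
qed (use carr sq_le in auto)

text \<open>Together with \<open>sq_le\<close> and \<open>sq_sq\<close> this makes
  \<open>a^2\<close> the largest idempotent below \<open>a\<close>: squaring is an interior
  operator.\<close>

lemma le_sqI:
  assumes "c \<^bold>\<le> a" "sq L c = c" "a \<in> carrier L" "c \<in> carrier L"
  shows "c \<^bold>\<le> sq L a"
  using assms by (metis sq_mono)

text \<open>The square of the meet is idempotent, so it can be split into two copies, one bounded by
  each square; conversely \<open>a * b\<close> lies below \<open>a \<and> b\<close>. Hence meet and
  product have the same square.\<close>

lemma sq_meet:
  assumes carr: "a \<in> carrier L" "b \<in> carrier L"
  shows "sq L (a \<^bold>\<and> b) = sq L a \<^bold>* sq L b"
proof (rule le_antisym)
  have "sq L (a \<^bold>\<and> b) = sq L (a \<^bold>\<and> b) \<^bold>* sq L (a \<^bold>\<and> b)"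
    using carr by (metis meet_closed sq_def sq_sq)
  also have "\<dots> \<^bold>\<le> sq L a \<^bold>* sq L b"
    using carr by (simp add: mult_mono sq_mono meet_le1 meet_le2)
  finally show "sq L (a \<^bold>\<and> b) \<^bold>\<le> sq L a \<^bold>* sq L b" .
  have "sq L (a \<^bold>* b) \<^bold>\<le> sq L (a \<^bold>\<and> b)"
    using carr by (simp add: sq_mono le_meetI mult_le1 mult_le2)
  then show "sq L a \<^bold>* sq L b \<^bold>\<le> sq L (a \<^bold>\<and> b)"
    using carr by (simp add: sq_mult)
qed (use carr in auto)

text \<open>It suffices to bound the cube of \<open>a \<or> b\<close>. Expanded, every product of
  three factors taken from \<open>a\<close> and \<open>b\<close> contains \<open>a^2\<close> or
  \<open>b^2\<close>; the numbered facts carry out the expansion one factor at a time.\<close>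

lemma sq_join:
  assumes carr: "a \<in> carrier L" "b \<in> carrier L"
  shows "sq L (a \<^bold>\<or> b) = sq L a \<^bold>\<or> sq L b"
proof (rule le_antisym)
  let ?j = "a \<^bold>\<or> b" and ?s = "sq L a \<^bold>\<or> sq L b"
  have up: "x \<^bold>\<le> ?s" if "x \<^bold>\<le> sq L a \<or> x \<^bold>\<le> sq L b" "x \<in> carrier L" for x
    using that carr by (meson join_closed le_join1 le_join2 le_trans sq_closed)
  have aa: "x \<^bold>* (a \<^bold>* a) \<^bold>\<le> ?s" and bb: "x \<^bold>* (b \<^bold>* b) \<^bold>\<le> ?s" if "x \<in> carrier L" for x
    using that carr mult_le2[of x "sq L a"] mult_le2[of x "sq L b"]
      up[of "x \<^bold>* sq L a"] up[of "x \<^bold>* sq L b"]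
    by (simp_all add: sq_def)
  have 1: "?j \<^bold>* (a \<^bold>* b) \<^bold>\<le> ?s"
    using carr aa[of b] bb[of a] by (intro mult_join_le) (auto simp: mult_ac)
  have 2: "?j \<^bold>* (?j \<^bold>* a) \<^bold>\<le> ?s"
  proof -
    have "a \<^bold>* (?j \<^bold>* a) \<^bold>\<le> ?s"
      using carr aa[of ?j] by (simp add: mult_ac)
    moreover have "b \<^bold>* (?j \<^bold>* a) \<^bold>\<le> ?s"
      using carr 1 by (simp add: mult_ac)
    ultimately show ?thesis using carr by (intro mult_join_le) auto
  qed
  have 3: "?j \<^bold>* (?j \<^bold>* b) \<^bold>\<le> ?s"
  proof -
    have "a \<^bold>* (?j \<^bold>* b) \<^bold>\<le> ?s"
      using carr 1 by (simp add: mult_ac)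
    moreover have "b \<^bold>* (?j \<^bold>* b) \<^bold>\<le> ?s"
      using carr bb[of ?j] by (simp add: mult_ac)
    ultimately show ?thesis using carr by (intro mult_join_le) auto
  qed
  have "?j \<^bold>* (?j \<^bold>* ?j) \<^bold>\<le> ?s"
    using carr 2 3 mult_join_le[of a "?j \<^bold>* ?j" ?s b] by (simp add: mult_ac)
  \<comment> \<open>By \<open>sq_sq\<close> the square equals the fourth power, which lies below the
    cube.\<close>
  moreover have "sq L ?j \<^bold>\<le> ?j \<^bold>* (?j \<^bold>* ?j)"
    using carr sq_sq[of ?j] mult_le1[of "?j \<^bold>* (?j \<^bold>* ?j)" ?j]
    by (simp add: sq_def mult_ac)
  ultimately show "sq L ?j \<^bold>\<le> ?s"
    using carr by (meson join_closed le_trans mult_closed sq_closed)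
  show "?s \<^bold>\<le> sq L ?j"
    using carr by (simp add: join_leI sq_mono le_join1 le_join2)
qed (use carr in auto)

lemma sq_mult_sq_neg:
  assumes "a \<in> carrier L"
  shows "sq L a \<^bold>* sq L (\<^bold>\<not> a) = \<^bold>\<bottom>"
  using assms neg_mult[of a] sq_mult[of "\<^bold>\<not> a" a] sq_le[of "\<^bold>\<bottom>"]
  by (simp add: mult_comm le_bot_iff)

lemma sq_imp_le:
  assumes carr: "a \<in> carrier L" "b \<in> carrier L"
  shows "sq L (a \<^bold>\<rightarrow> b) \<^bold>\<le> sq L (sq L a \<^bold>\<rightarrow> sq L b)"
proof (rule le_sqI)
  have "sq L ((a \<^bold>\<rightarrow> b) \<^bold>* a) \<^bold>\<le> sq L b"
    using carr by (simp add: sq_mono imp_mult_le)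
  then show "sq L (a \<^bold>\<rightarrow> b) \<^bold>\<le> sq L a \<^bold>\<rightarrow> sq L b"
    using carr by (simp add: sq_mult residuation)
qed (use carr in auto)

text \<open>This is the first coordinate of implication in the twist structure. One inequality is
  squared modus ponens, for the implication and for its contrapositive. For the other,
  \<open>?p\<close> and \<open>?q\<close> supply the two premises of \<open>nelson_le\<close>, and
  idempotence of their product lets the bound pass to the square.\<close>

lemma sq_imp:
  assumes carr: "a \<in> carrier L" "b \<in> carrier L"
  shows "sq L (a \<^bold>\<rightarrow> b)
    = sq L (sq L a \<^bold>\<rightarrow> sq L b) \<^bold>* sq L (sq L (\<^bold>\<not> b) \<^bold>\<rightarrow> sq L (\<^bold>\<not> a))" (is "_ = ?p \<^bold>* ?q")
proof (rule le_antisym)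
  have "sq L (a \<^bold>\<rightarrow> b) \<^bold>\<le> ?q"
    using carr sq_imp_le[of "\<^bold>\<not> b" "\<^bold>\<not> a"] by (simp flip: imp_contrapos)
  then have "sq L (a \<^bold>\<rightarrow> b) \<^bold>* sq L (a \<^bold>\<rightarrow> b) \<^bold>\<le> ?p \<^bold>* ?q"
    using carr sq_imp_le[of a b] by (intro mult_mono) auto
  then show "sq L (a \<^bold>\<rightarrow> b) \<^bold>\<le> ?p \<^bold>* ?q"
    using carr by (metis imp_closed sq_def sq_sq)
  \<comment> \<open>Discarding both squares that only lower the left side or raise the right one
    leaves plain modus ponens.\<close>
  have imp: "sq L (u \<^bold>\<rightarrow> sq L v) \<^bold>* u \<^bold>\<le> v" if "u \<in> carrier L" "v \<in> carrier L" for u v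
    using that by (meson imp_closed le_trans residuation sq_closed sq_le mult_closed)
  have "?p \<^bold>* ?q \<^bold>\<le> a \<^bold>\<rightarrow> b"
  proof (rule nelson_le)
    have "(?p \<^bold>* ?q) \<^bold>* sq L a \<^bold>\<le> ?p \<^bold>* sq L a"
      using carr by (simp add: mult_mono1 mult_le1)
    then show "(?p \<^bold>* ?q) \<^bold>* sq L a \<^bold>\<le> b"
      using carr imp[of "sq L a" b] by (meson imp_closed le_trans sq_closed mult_closed neg_closed)
    have "(?p \<^bold>* ?q) \<^bold>* sq L (\<^bold>\<not> b) \<^bold>\<le> ?q \<^bold>* sq L (\<^bold>\<not> b)"
      using carr by (simp add: mult_mono1 mult_le2)
    then show "(?p \<^bold>* ?q) \<^bold>* sq L (\<^bold>\<not> b) \<^bold>\<le> \<^bold>\<not> a"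
      using carr imp[of "sq L (\<^bold>\<not> b)" "\<^bold>\<not> a"]
      by (meson imp_closed le_trans sq_closed mult_closed neg_closed)
  qed (use carr in auto)
  then show "?p \<^bold>* ?q \<^bold>\<le> sq L (a \<^bold>\<rightarrow> b)"
    using carr by (intro le_sqI) (auto simp: sq_mult)
qed (use carr in auto)

end

section \<open>The associated modal Heyting algebra\<close>

context modal_nelson_lattice
begin

declare nbox_closed [simp, intro] ndia_closed [simp, intro]

abbreviation "H \<equiv> assoc_modal_heyting N"

lemma assoc_carrier: "a \<in> carrier H \<longleftrightarrow> a \<in> carrier N \<and> sq N a = a"
  by (simp add: assoc_modal_heyting_def)

lemma assoc_sq_closed [simp, intro]: "a \<in> carrier N \<Longrightarrow> sq N a \<in> carrier H"
  by (simp add: assoc_carrier)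

lemma assoc_carrierD: "a \<in> carrier H \<Longrightarrow> a \<in> carrier N" "a \<in> carrier H \<Longrightarrow> sq N a = a"
  by (simp_all add: assoc_carrier)

text \<open>By \<open>sq_meet\<close> the Heyting meet of idempotents is their product, so the
  monoid laws serve as its lattice laws. Likewise \<open>sq_join\<close> makes the Heyting join the
  original one.\<close>

lemma assoc_meet: "\<lbrakk>a \<in> carrier H; b \<in> carrier H\<rbrakk> \<Longrightarrow> a \<^bold>\<and>\<^bsub>H\<^esub> b = a \<^bold>* b"
  using assoc_carrier[of a] assoc_carrier[of b] by (simp add: assoc_modal_heyting_def sq_meet)

lemma assoc_join: "\<lbrakk>a \<in> carrier H; b \<in> carrier H\<rbrakk> \<Longrightarrow> a \<^bold>\<or>\<^bsub>H\<^esub> b = a \<^bold>\<or> b"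
  using assoc_carrier[of a] assoc_carrier[of b] by (simp add: assoc_modal_heyting_def sq_join)

lemma assoc_imp: "\<lbrakk>a \<in> carrier H; b \<in> carrier H\<rbrakk> \<Longrightarrow> a \<^bold>\<rightarrow>\<^bsub>H\<^esub> b = sq N (a \<^bold>\<rightarrow> b)"
  using assoc_carrier[of a] assoc_carrier[of b] by (simp add: assoc_modal_heyting_def)

lemma assoc_top: "\<^bold>\<top>\<^bsub>H\<^esub> = \<^bold>\<top>" and assoc_bot: "\<^bold>\<bottom>\<^bsub>H\<^esub> = \<^bold>\<bottom>"
  by (simp_all add: assoc_modal_heyting_def)

lemma assoc_box: "hbox H a = sq N (nbox N a)" and assoc_dia: "hdia H a = sq N (ndia N a)"
  by (simp_all add: assoc_modal_heyting_def)

lemma assoc_neg: "a \<in> carrier H \<Longrightarrow> \<^bold>\<not>\<^bsub>H\<^esub> a = sq N (\<^bold>\<not> a)"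
  using assoc_carrier[of a] by (simp add: neg_op_def assoc_modal_heyting_def)

lemma sq_top: "sq N \<^bold>\<top> = \<^bold>\<top>" and sq_bot: "sq N \<^bold>\<bottom> = \<^bold>\<bottom>"
  using sq_le[of "\<^bold>\<bottom>"] by (simp_all add: sq_def top_mult le_bot_iff)

lemma assoc_mult_closed: "\<lbrakk>a \<in> carrier H; b \<in> carrier H\<rbrakk> \<Longrightarrow> a \<^bold>* b \<in> carrier H"
  by (simp add: assoc_carrier sq_mult)

lemma assoc_join_closed: "\<lbrakk>a \<in> carrier H; b \<in> carrier H\<rbrakk> \<Longrightarrow> a \<^bold>\<or> b \<in> carrier H"
  by (simp add: assoc_carrier sq_join)

text \<open>If \<open>a \<le> b\<close>, idempotence gives \<open>a = a * a \<le> a * b\<close>. As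
  the Heyting meet is the product, the order of \<open>H\<close> is the restriction of that of
  \<open>N\<close>.\<close>

lemma mult_eq_iff_le:
  assumes "a \<in> carrier H" "b \<in> carrier N"
  shows "a \<^bold>* b = a \<longleftrightarrow> a \<^bold>\<le> b"
proof
  have a: "a \<in> carrier N" "a \<^bold>* a = a"
    using assms by (auto simp: assoc_carrier sq_def)
  show "a \<^bold>\<le> b" if "a \<^bold>* b = a"
    using that a assms mult_le2[of a b] by simp
  show "a \<^bold>* b = a" if "a \<^bold>\<le> b"
    using that a assms mult_mono[of a a a b] le_antisym[of "a \<^bold>* b" a] by (simp add: mult_le1)
qed

lemma assoc_le: "\<lbrakk>a \<in> carrier H; b \<in> carrier H\<rbrakk> \<Longrightarrow> a \<^bold>\<le>\<^bsub>H\<^esub> b \<longleftrightarrow> a \<^bold>\<le> b"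
  by (simp add: le_op_def[of H] assoc_meet mult_eq_iff_le assoc_carrierD)

lemma assoc_heyting: "heyting_algebra H"
proof
  show clm: "a \<^bold>\<and>\<^bsub>H\<^esub> b \<in> carrier H" if "a \<in> carrier H" "b \<in> carrier H" for a b
    using that by (simp add: assoc_meet assoc_mult_closed)
  show clj: "a \<^bold>\<or>\<^bsub>H\<^esub> b \<in> carrier H" if "a \<in> carrier H" "b \<in> carrier H" for a b
    using that by (simp add: assoc_join assoc_join_closed)
  show cli: "a \<^bold>\<rightarrow>\<^bsub>H\<^esub> b \<in> carrier H" if "a \<in> carrier H" "b \<in> carrier H" for a b
    using that by (simp add: assoc_imp assoc_carrierD)
  show top: "\<^bold>\<top>\<^bsub>H\<^esub> \<in> carrier H" and bot: "\<^bold>\<bottom>\<^bsub>H\<^esub> \<in> carrier H"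
    by (simp_all add: assoc_top assoc_bot assoc_carrier sq_top sq_bot)
  show "a \<^bold>\<and>\<^bsub>H\<^esub> b = b \<^bold>\<and>\<^bsub>H\<^esub> a" if "a \<in> carrier H" "b \<in> carrier H" for a b
    using that by (simp add: assoc_meet mult_comm assoc_carrierD)
  show "a \<^bold>\<or>\<^bsub>H\<^esub> b = b \<^bold>\<or>\<^bsub>H\<^esub> a" if "a \<in> carrier H" "b \<in> carrier H" for a b
    using that by (simp add: assoc_join join_comm assoc_carrierD)
  show "(a \<^bold>\<and>\<^bsub>H\<^esub> b) \<^bold>\<and>\<^bsub>H\<^esub> c = a \<^bold>\<and>\<^bsub>H\<^esub> (b \<^bold>\<and>\<^bsub>H\<^esub> c)"
    if "a \<in> carrier H" "b \<in> carrier H" "c \<in> carrier H" for a b c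
    using that by (simp add: assoc_meet assoc_mult_closed mult_assoc assoc_carrierD)
  show "(a \<^bold>\<or>\<^bsub>H\<^esub> b) \<^bold>\<or>\<^bsub>H\<^esub> c = a \<^bold>\<or>\<^bsub>H\<^esub> (b \<^bold>\<or>\<^bsub>H\<^esub> c)"
    if "a \<in> carrier H" "b \<in> carrier H" "c \<in> carrier H" for a b c
    using that by (simp add: assoc_join assoc_join_closed join_assoc assoc_carrierD)
  show "a \<^bold>\<and>\<^bsub>H\<^esub> (a \<^bold>\<or>\<^bsub>H\<^esub> b) = a" if "a \<in> carrier H" "b \<in> carrier H" for a b
    using that
    by (simp add: assoc_meet assoc_join assoc_join_closed mult_eq_iff_le le_join1 assoc_carrierD)
  show "a \<^bold>\<or>\<^bsub>H\<^esub> (a \<^bold>\<and>\<^bsub>H\<^esub> b) = a" if "a \<in> carrier H" "b \<in> carrier H" for a b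
    using that mult_le1[of a b] join_comm[of a "a \<^bold>* b"] le_iff_join[of "a \<^bold>* b" a]
    by (simp add: assoc_meet assoc_join assoc_mult_closed assoc_carrierD)
  show "a \<^bold>\<le>\<^bsub>H\<^esub> \<^bold>\<top>\<^bsub>H\<^esub>" "\<^bold>\<bottom>\<^bsub>H\<^esub> \<^bold>\<le>\<^bsub>H\<^esub> a" if "a \<in> carrier H" for a
    using that top bot by (simp_all add: assoc_le) (simp_all add: assoc_top assoc_bot assoc_carrierD)
  show "a \<^bold>\<and>\<^bsub>H\<^esub> b \<^bold>\<le>\<^bsub>H\<^esub> c \<longleftrightarrow> a \<^bold>\<le>\<^bsub>H\<^esub> b \<^bold>\<rightarrow>\<^bsub>H\<^esub> c"
    if "a \<in> carrier H" "b \<in> carrier H" "c \<in> carrier H" for a b c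
  proof -
    note carr = that[THEN assoc_carrierD(1)]
    have "a \<^bold>\<and>\<^bsub>H\<^esub> b \<^bold>\<le>\<^bsub>H\<^esub> c \<longleftrightarrow> a \<^bold>\<le> b \<^bold>\<rightarrow> c"
      using that carr clm[of a b] by (simp add: assoc_le assoc_meet residuation)
    \<comment> \<open>An idempotent lies below an element exactly when it lies below its
      square.\<close>
    also have "\<dots> \<longleftrightarrow> a \<^bold>\<le> sq N (b \<^bold>\<rightarrow> c)"
      using that carr by (meson assoc_carrierD(2) imp_closed le_sqI le_trans sq_closed sq_le)
    finally show ?thesis
      using that cli[of b c] by (simp add: assoc_le assoc_imp)
  qed
qed

sublocale H: heyting_algebra H
  by (rule assoc_heyting)

section \<open>Coordinates of the Nelson operations as Heyting terms\<close>

lemma sq_meet': "\<lbrakk>a \<in> carrier N; b \<in> carrier N\<rbrakk> \<Longrightarrow> sq N (a \<^bold>\<and> b) = sq N a \<^bold>\<and>\<^bsub>H\<^esub> sq N b"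
  by (simp add: sq_meet assoc_meet)

lemma sq_mult': "\<lbrakk>a \<in> carrier N; b \<in> carrier N\<rbrakk> \<Longrightarrow> sq N (a \<^bold>* b) = sq N a \<^bold>\<and>\<^bsub>H\<^esub> sq N b"
  by (simp add: sq_mult assoc_meet)

lemma sq_join': "\<lbrakk>a \<in> carrier N; b \<in> carrier N\<rbrakk> \<Longrightarrow> sq N (a \<^bold>\<or> b) = sq N a \<^bold>\<or>\<^bsub>H\<^esub> sq N b"
  by (simp add: sq_join assoc_join)

lemma sq_neg_sq': "a \<in> carrier N \<Longrightarrow> sq N (\<^bold>\<not> (sq N a)) = \<^bold>\<not>\<^bsub>H\<^esub> sq N a"
  by (simp add: assoc_neg)

lemma sq_imp':
  "\<lbrakk>a \<in> carrier N; b \<in> carrier N\<rbrakk> \<Longrightarrow> sq N (a \<^bold>\<rightarrow> b)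
    = (sq N a \<^bold>\<rightarrow>\<^bsub>H\<^esub> sq N b) \<^bold>\<and>\<^bsub>H\<^esub> (sq N (\<^bold>\<not> b) \<^bold>\<rightarrow>\<^bsub>H\<^esub> sq N (\<^bold>\<not> a))"
  by (simp add: sq_imp[of a b] assoc_imp assoc_meet)

text \<open>Since \<open>a\<close> and \<open>a^2\<close> have the same square, the congruence axiom
  lets the box be evaluated at the first coordinate.\<close>

lemma sq_box: "a \<in> carrier N \<Longrightarrow> sq N (nbox N a) = hbox H (sq N a)"
  by (simp add: assoc_box) (rule nbox_cong; simp)

lemma sq_dia: "a \<in> carrier N \<Longrightarrow> sq N (ndia N a) = hdia H (sq N a)"
  by (simp add: assoc_dia) (rule ndia_cong; simp)

lemma neg_box: "a \<in> carrier N \<Longrightarrow> \<^bold>\<not> (nbox N a) = ndia N (\<^bold>\<not> a)"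
  by (simp add: ndia_eq involutive)

lemma neg_dia: "a \<in> carrier N \<Longrightarrow> \<^bold>\<not> (ndia N a) = nbox N (\<^bold>\<not> a)"
  by (simp add: ndia_eq involutive)

lemma sq_disjoint: "a \<in> carrier N \<Longrightarrow> sq N a \<^bold>\<and>\<^bsub>H\<^esub> sq N (\<^bold>\<not> a) = \<^bold>\<bottom>\<^bsub>H\<^esub>"
  by (simp add: assoc_meet assoc_bot sq_mult_sq_neg)

text \<open>These rules push squares and negations inwards, turning both coordinates of a compound
  element into Heyting terms in the coordinates of its parts.\<close>

lemmas coord_simps = sq_meet' sq_mult' sq_join' sq_neg_sq' sq_imp' sq_box sq_dia
  neg_box neg_dia neg_meet neg_join neg_imp neg_mult_eq_imp involutive sq_sq

text \<open>The axiom linking box and diamond is \<open>nbox_ndia\<close> with its square pushed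
  inwards.\<close>

lemma assoc_modal: "modal_heyting_algebra H"
proof
  show "hbox H a \<in> carrier H" "hdia H a \<in> carrier H" if "a \<in> carrier H" for a
    using that by (simp_all add: assoc_box assoc_dia assoc_carrierD)
  show "hbox H a \<^bold>\<and>\<^bsub>H\<^esub> hdia H (\<^bold>\<not>\<^bsub>H\<^esub> a \<^bold>\<and>\<^bsub>H\<^esub> b) = \<^bold>\<bottom>\<^bsub>H\<^esub>"
    if "a \<in> carrier H" "b \<in> carrier H" for a b
  proof -
    have "\<^bold>\<bottom>\<^bsub>H\<^esub> = sq N (nbox N a \<^bold>\<and> ndia N (\<^bold>\<not> (sq N a) \<^bold>\<and> b))"
      using that nbox_ndia[of a b] by (simp add: assoc_carrierD assoc_bot)
    also have "\<dots> = hbox H a \<^bold>\<and>\<^bsub>H\<^esub> hdia H (\<^bold>\<not>\<^bsub>H\<^esub> a \<^bold>\<and>\<^bsub>H\<^esub> b)"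
      using that by (simp add: coord_simps assoc_neg assoc_carrierD)
    finally show ?thesis by simp
  qed
qed

sublocale H: modal_heyting_algebra H
  by (rule assoc_modal)

text \<open>Injectivity is \<open>eq_of_sq_eq\<close>, the homomorphism equations are the coordinate
  formulas, and \<open>sq_disjoint\<close> puts the image inside the twist carrier. The image itself
  is the subuniverse.\<close>

lemma embeds_into_twist: "isomorphic_to_subalgebra N (twist H)"
proof -
  let ?h = "\<lambda>x. (sq N x, sq N (\<^bold>\<not> x))" and ?T = "twist H"
  let ?S = "?h ` carrier N"
  have inj: "inj_on ?h (carrier N)"
    by (auto intro: inj_onI eq_of_sq_eq)
  have top: "?h \<^bold>\<top> = \<^bold>\<top>\<^bsub>?T\<^esub>" and bot: "?h \<^bold>\<bottom> = \<^bold>\<bottom>\<^bsub>?T\<^esub>"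
    by (simp_all add: twist_def assoc_top assoc_bot neg_top neg_bot sq_top sq_bot)
  have meet: "?h (a \<^bold>\<and> b) = ?h a \<^bold>\<and>\<^bsub>?T\<^esub> ?h b"
    and join: "?h (a \<^bold>\<or> b) = ?h a \<^bold>\<or>\<^bsub>?T\<^esub> ?h b"
    and mult: "?h (a \<^bold>* b) = ?h a \<^bold>*\<^bsub>?T\<^esub> ?h b"
    and imp: "?h (a \<^bold>\<rightarrow> b) = ?h a \<^bold>\<rightarrow>\<^bsub>?T\<^esub> ?h b"
    if "a \<in> carrier N" "b \<in> carrier N" for a b
    using that by (simp_all add: twist_def coord_simps)
  have box: "?h (nbox N a) = nbox ?T (?h a)" and dia: "?h (ndia N a) = ndia ?T (?h a)"
    if "a \<in> carrier N" for a
    using that by (simp_all add: twist_def coord_simps)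
  have "subuniverse ?S ?T"
    unfolding subuniverse_def
  proof (intro conjI ballI)
    show "?S \<subseteq> carrier ?T"
      by (auto simp: twist_def sq_disjoint)
    \<comment> \<open>Closure comes from reading the homomorphism equations from right to left: each
      result is again a value of \<open>?h\<close>.\<close>
    show "\<^bold>\<top>\<^bsub>?T\<^esub> \<in> ?S" "\<^bold>\<bottom>\<^bsub>?T\<^esub> \<in> ?S"
      unfolding top[symmetric] bot[symmetric] by (rule imageI; simp)+
  next
    fix u v assume "u \<in> ?S" "v \<in> ?S"
    then obtain a b where ab: "u = ?h a" "v = ?h b" "a \<in> carrier N" "b \<in> carrier N"
      by auto
    show "u \<^bold>\<and>\<^bsub>?T\<^esub> v \<in> ?S" "u \<^bold>\<or>\<^bsub>?T\<^esub> v \<in> ?S" "u \<^bold>*\<^bsub>?T\<^esub> v \<in> ?S" "u \<^bold>\<rightarrow>\<^bsub>?T\<^esub> v \<in> ?S"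
      unfolding ab(1,2) using ab(3,4)
      by (simp_all only: meet[symmetric] join[symmetric] mult[symmetric] imp[symmetric])
        (rule imageI; simp)+
  next
    fix u assume "u \<in> ?S"
    then obtain a where a: "u = ?h a" "a \<in> carrier N" by auto
    show "nbox ?T u \<in> ?S" "ndia ?T u \<in> ?S"
      unfolding a(1) using a(2)
      by (simp_all only: box[symmetric] dia[symmetric]) (rule imageI; simp)+
  qed
  moreover have "?h \<in> modal_nelson_iso N (?T\<lparr>carrier := ?S\<rparr>)"
    unfolding modal_nelson_iso_def
    using inj top bot meet join mult imp box dia by (simp add: bij_betw_def)
  ultimately show ?thesis
    unfolding isomorphic_to_subalgebra_def by blast
qed

section \<open>Modal regularity\<close>

lemma sq_neg_sq_neg_sq:
  "x \<in> carrier N \<Longrightarrow> sq N (\<^bold>\<not> (sq N (\<^bold>\<not> (sq N x)))) = \<^bold>\<not>\<^bsub>H\<^esub> \<^bold>\<not>\<^bsub>H\<^esub> sq N x"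
  by (subst sq_neg_sq', simp, subst sq_neg_sq', simp_all)

text \<open>In coordinates \<open>nabla\<close> is \<open>(a, b) \<mapsto> (--a, -a)\<close>. By
  involutivity \<open>~nabla x\<close> is a square of a negated square, which yields the second
  entry.\<close>

lemma coord_nabla:
  assumes "x \<in> carrier N"
  shows "nabla N x \<in> carrier N"
    and "sq N (nabla N x) = \<^bold>\<not>\<^bsub>H\<^esub> \<^bold>\<not>\<^bsub>H\<^esub> sq N x"
    and "sq N (\<^bold>\<not> (nabla N x)) = \<^bold>\<not>\<^bsub>H\<^esub> sq N x"
  unfolding nabla_def using assms
  by (simp, simp add: sq_neg_sq_neg_sq, simp add: involutive flip: sq_neg_sq')

text \<open>The involution makes \<open>delta x\<close> the same as \<open>~nabla (~x)\<close>, so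
  in coordinates it is \<open>(a, b) \<mapsto> (-b, --b)\<close>.\<close>

lemma coord_delta:
  assumes "x \<in> carrier N"
  shows "delta N x \<in> carrier N"
    and "sq N (delta N x) = \<^bold>\<not>\<^bsub>H\<^esub> sq N (\<^bold>\<not> x)"
    and "sq N (\<^bold>\<not> (delta N x)) = \<^bold>\<not>\<^bsub>H\<^esub> \<^bold>\<not>\<^bsub>H\<^esub> sq N (\<^bold>\<not> x)"
  unfolding delta_def using assms
  by (simp, simp flip: sq_neg_sq', simp add: sq_neg_sq_neg_sq)

lemma phi_closed [simp, intro]: "x \<in> carrier N \<Longrightarrow> phi N x \<in> carrier N"
  by (simp add: phi_def coord_nabla coord_delta)

lemma sq_phi:
  assumes "x \<in> carrier N"
  shows "sq N (phi N x) = \<^bold>\<not>\<^bsub>H\<^esub> \<^bold>\<not>\<^bsub>H\<^esub> sq N x"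
proof -
  have "sq N (phi N x) = \<^bold>\<not>\<^bsub>H\<^esub> sq N (\<^bold>\<not> x)
      \<^bold>\<and>\<^bsub>H\<^esub> (\<^bold>\<not>\<^bsub>H\<^esub> \<^bold>\<not>\<^bsub>H\<^esub> (sq N x \<^bold>\<or>\<^bsub>H\<^esub> sq N (\<^bold>\<not> x)) \<^bold>\<or>\<^bsub>H\<^esub> sq N x)"
    using assms by (simp add: phi_def coord_nabla coord_delta coord_simps)
  with assms show ?thesis
    by (simp add: H.phi_fst sq_disjoint)
qed

lemma sq_neg_phi:
  assumes "x \<in> carrier N"
  shows "sq N (\<^bold>\<not> (phi N x)) = \<^bold>\<not>\<^bsub>H\<^esub> \<^bold>\<not>\<^bsub>H\<^esub> sq N (\<^bold>\<not> x)"
proof -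
  have "sq N (\<^bold>\<not> (phi N x)) = \<^bold>\<not>\<^bsub>H\<^esub> \<^bold>\<not>\<^bsub>H\<^esub> sq N (\<^bold>\<not> x)
      \<^bold>\<or>\<^bsub>H\<^esub> (\<^bold>\<not>\<^bsub>H\<^esub> (sq N x \<^bold>\<or>\<^bsub>H\<^esub> sq N (\<^bold>\<not> x)) \<^bold>\<and>\<^bsub>H\<^esub> sq N (\<^bold>\<not> x))"
    using assms by (simp add: phi_def coord_nabla coord_delta coord_simps)
  with assms show ?thesis
    by (simp add: H.phi_snd)
qed

lemma modal_phi_regular_iff:
  "modal_phi_regular_nelson_lattice N
    \<longleftrightarrow> crisp_witnessed_modal_heyting_algebra H \<and> stone_identity H"
proof (intro iffI conjI)
  assume "modal_phi_regular_nelson_lattice N"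
  then interpret R: modal_phi_regular_nelson_lattice N .
  show "stone_identity H"
    unfolding stone_identity_def
  proof
    fix x assume x: "x \<in> carrier H"
    let ?y = "\<^bold>\<not>\<^bsub>H\<^esub> x"
    have y: "?y \<in> carrier H" using x by simp
    \<comment> \<open>Preservation of joins is tested at \<open>x\<close> and \<open>-x\<close>. In
      the first coordinate the left side becomes top by \<open>dneg_join_neg\<close>, and on the
      right the triple negation reduces to a single one.\<close>
    have "sq N (phi N (x \<^bold>\<or> ?y)) = sq N (phi N x \<^bold>\<or> phi N ?y)"
      using x y by (simp add: R.phi_join assoc_carrierD)
    then have "\<^bold>\<not>\<^bsub>H\<^esub> \<^bold>\<not>\<^bsub>H\<^esub> (x \<^bold>\<or>\<^bsub>H\<^esub> ?y) = \<^bold>\<not>\<^bsub>H\<^esub> \<^bold>\<not>\<^bsub>H\<^esub> x \<^bold>\<or>\<^bsub>H\<^esub> \<^bold>\<not>\<^bsub>H\<^esub> \<^bold>\<not>\<^bsub>H\<^esub> ?y"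
      using x y by (simp add: sq_phi sq_join' assoc_carrierD)
    then show "?y \<^bold>\<or>\<^bsub>H\<^esub> \<^bold>\<not>\<^bsub>H\<^esub> ?y = \<^bold>\<top>\<^bsub>H\<^esub>"
      using x by (simp add: H.dneg_join_neg H.neg_neg_neg H.join_comm)
  qed
  show "crisp_witnessed_modal_heyting_algebra H"
  proof
    fix x assume x: "x \<in> carrier H"
    then have "sq N (nbox N (phi N x)) = sq N (phi N (nbox N x))"
      by (simp add: R.nbox_phi assoc_carrierD)
    with x show "\<^bold>\<not>\<^bsub>H\<^esub> \<^bold>\<not>\<^bsub>H\<^esub> hbox H x = hbox H (\<^bold>\<not>\<^bsub>H\<^esub> \<^bold>\<not>\<^bsub>H\<^esub> x)"
      by (simp add: sq_box sq_phi assoc_carrierD)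
    \<comment> \<open>The diamond law is the second coordinate of \<open>nbox_phi\<close> at
      \<open>~x\<close>: there the box turns into the diamond, and the second coordinate of
      \<open>~x\<close> is \<open>x\<close>, an idempotent.\<close>
    from x have "sq N (\<^bold>\<not> (nbox N (phi N (\<^bold>\<not> x)))) = sq N (\<^bold>\<not> (phi N (nbox N (\<^bold>\<not> x))))"
      by (simp add: R.nbox_phi assoc_carrierD)
    with x show "\<^bold>\<not>\<^bsub>H\<^esub> \<^bold>\<not>\<^bsub>H\<^esub> hdia H x = hdia H (\<^bold>\<not>\<^bsub>H\<^esub> \<^bold>\<not>\<^bsub>H\<^esub> x)"
      by (simp add: neg_box sq_dia sq_neg_phi involutive assoc_carrierD)
  qed
next
  assume asm: "crisp_witnessed_modal_heyting_algebra H \<and> stone_identity H"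
  then interpret C: crisp_witnessed_modal_heyting_algebra H by simp
  note dneg_join = H.stone_dneg_join[OF conjunct2[OF asm]]
  note simps = coord_simps sq_phi sq_neg_phi H.dneg_meet dneg_join
  show "modal_phi_regular_nelson_lattice N"
  proof
    show "phi N (x \<^bold>\<or> y) = phi N x \<^bold>\<or> phi N y" "phi N (x \<^bold>\<and> y) = phi N x \<^bold>\<and> phi N y"
      if "x \<in> carrier N" "y \<in> carrier N" for x y
      \<comment> \<open>For joins the first coordinate needs \<open>dneg_join\<close> and the second
        \<open>H.dneg_meet\<close>; for meets the roles are exchanged.\<close>
      using that by - (rule eq_of_sq_eq; simp add: simps)+
    show "nbox N (phi N x) = phi N (nbox N x)" if "x \<in> carrier N" for x
      \<comment> \<open>The first coordinate is the crisp law for the box, the second the one for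
        the diamond.\<close>
      using that by - (rule eq_of_sq_eq; simp add: simps C.crisp_box C.crisp_dia)
  qed
qed

end

theorem theorem10:
  fixes N :: "'a modal_nelson_struct"
  assumes "modal_nelson_lattice N"
  shows "modal_heyting_algebra (assoc_modal_heyting N)
    \<and> isomorphic_to_subalgebra N (twist (assoc_modal_heyting N))
    \<and> (modal_phi_regular_nelson_lattice N \<longleftrightarrow>
         crisp_witnessed_modal_heyting_algebra (assoc_modal_heyting N)
         \<and> stone_identity (assoc_modal_heyting N))"
  using modal_nelson_lattice.assoc_modal[OF assms] modal_nelson_lattice.embeds_into_twist[OF assms]
    modal_nelson_lattice.modal_phi_regular_iff[OF assms] by (intro conjI)

end
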